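(* Let $(X,d)$ be a finite quasihypermetric space. (1) The following conditions are equivalent: (a) $M(X)<\infty$. (b) There exists a $d$-invariant measure in $\mathcal{M}_1(X)$. (c) Some S-embedding of $X$ in a euclidean space lies on a sphere. (d) Every S-embedding of $X$ in a euclidean space lies on a sphere. (2) The following conditions are equivalent: (a) $M^+(X)=M(X)$. (b) There exists a $d$-invariant measure in $\mathcal{M}_1^+(X)$. (c) Some S-embedding of $X$ in a euclidean space of minimal dimension lies on a sphere whose centre is in the convex hull of the S-embedded set. (d) Every S-embedding of $X$ in a euclidean space of minimal dimension lies on a sphere whose centre is in the convex hull of the S-embedded set. (3) The following conditions are equivalent: (a) $X$ is strictly quasihypermetric. (b) There exists a unique $d$-invariant measure in $\mathcal{M}_1(X)$. (c) Some S-embedding of $X$ in a euclidean space is an affinely independent set. (d) Every S-embedding of $X$ in a euclidean space is an affinely independent set.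
   Context: Metric spaces are non-empty. For a compact (in particular finite) metric space $(X,d)$, $\mathcal{M}(X)$ is the space of finite signed Borel measures on $X$; $\mathcal{M}_0(X)$ and $\mathcal{M}_1(X)$ are the sets of those of total mass $0$ and $1$ respectively; $\mathcal{M}_1^+(X)$ is the set of probability measures. $I(\mu)=\int_X\int_X d(x,y)\,d\mu(x)\,d\mu(y)$, $M(X)=\sup\{I(\mu):\mu\in\mathcal{M}_1(X)\}\in[0,\infty]$, $M^+(X)=\sup\{I(\mu):\mu\in\mathcal{M}_1^+(X)\}$, and $d_\mu(x)=\int_X d(x,y)\,d\mu(y)$. A measure $\mu\in\mathcal{M}(X)$ is $d$-invariant if the function $d_\mu$ is constant on $X$. $(X,d)$ is quasihypermetric if $\sum_{i,j=1}^n\alpha_i\alpha_jd(x_i,x_j)\le 0$ for all $n\in\mathbb{N}$, all $x_1,\dots,x_n\in X$ and all real $\alpha_1,\dots,\alpha_n$ with $\sum_i\alpha_i=0$. A compact quasihypermetric space $X$ is strictly quasihypermetric if $\mu\in\mathcal{M}_0(X)$ and $I(\mu)=0$ imply $\mu=0$. A euclidean space is $\mathbb{R}^m$ ($m\ge 0$) with the euclidean norm. An S-embedding of $X$ in a euclidean space is an isometric embedding of $(X,d^{1/2})$ into it, i.e. a map $\varphi$ with $\|\varphi(x)-\varphi(y)\|^2=d(x,y)$ for all $x,y\in X$; it is said to lie on a sphere, or to be affinely independent, if its image $\varphi(X)$ (the S-embedded set) lies on a sphere, or is affinely independent. It is into a euclidean space of minimal dimension if its target is $\mathbb{R}^k$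 with $k$ the least dimension of a euclidean space in which $X$ has an S-embedding. A sphere is a set $\{y:\|y-z\|=r\}$ for a point $z$ (its centre) and a radius $r\ge 0$ (radius $0$ allowed for the degenerate one-point case). *)

theory Defs
  imports "HOL-Analysis.Analysis" "HOL-Analysis.Finite_Function_Topology"
begin

section \<open>Signed Borel measures on a metric space\<close>

definition metric_borel :: "'a set \<Rightarrow> ('a \<Rightarrow> 'a \<Rightarrow> real) \<Rightarrow> 'a measure" where
  "metric_borel X d = sigma X {U. openin (Metric_space.mtopology X d) U}"

text \<open>
  A finite signed measure is a countably additive real-valued set function on the Borel sets.
  It is set to \<open>0\<close> on all other sets, so that equality of measures is equality of functions.
\<close>

definition signed_measures :: "'a set \<Rightarrow> ('a \<Rightarrow> 'a \<Rightarrow> real) \<Rightarrow> ('a set \<Rightarrow> real) set" where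
  "signed_measures X d = {\<mu>.
     (\<forall>A. A \<notin> sets (metric_borel X d) \<longrightarrow> \<mu> A = 0) \<and>
     \<mu> {} = 0 \<and>
     (\<forall>A::nat \<Rightarrow> 'a set. range A \<subseteq> sets (metric_borel X d) \<and> disjoint_family A \<longrightarrow>
        (\<lambda>i. \<mu> (A i)) sums \<mu> (\<Union>i. A i))}"

definition signed_measures_0 :: "'a set \<Rightarrow> ('a \<Rightarrow> 'a \<Rightarrow> real) \<Rightarrow> ('a set \<Rightarrow> real) set" where
  "signed_measures_0 X d = {\<mu> \<in> signed_measures X d. \<mu> X = 0}"

definition signed_measures_1 :: "'a set \<Rightarrow> ('a \<Rightarrow> 'a \<Rightarrow> real) \<Rightarrow> ('a set \<Rightarrow> real) set" where
  "signed_measures_1 X d = {\<mu> \<in> signed_measures X d. \<mu> X = 1}"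

definition prob_measures :: "'a set \<Rightarrow> ('a \<Rightarrow> 'a \<Rightarrow> real) \<Rightarrow> ('a set \<Rightarrow> real) set" where
  "prob_measures X d =
     {\<mu> \<in> signed_measures_1 X d. \<forall>A \<in> sets (metric_borel X d). 0 \<le> \<mu> A}"

text \<open>
  The integral against \<open>\<mu>\<close> is the difference of the Lebesgue integrals against the two parts
  \<open>\<mu>\<^sup>+\<close>, \<open>\<mu>\<^sup>-\<close> of its Jordan decomposition, where \<open>\<mu>\<^sup>+\<close> is the upper variation
  \<open>\<mu>\<^sup>+(A) = sup {\<mu>(B) | B \<subseteq> A Borel}\<close> and \<open>\<mu>\<^sup>- = (-\<mu>)\<^sup>+\<close>. Truncation of negative values by
  \<open>ennreal\<close> is harmless, as \<open>B = {}\<close> contributes \<open>0\<close> to the supremum.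
\<close>

definition upper_variation ::
    "'a set \<Rightarrow> ('a \<Rightarrow> 'a \<Rightarrow> real) \<Rightarrow> ('a set \<Rightarrow> real) \<Rightarrow> 'a measure" where
  "upper_variation X d \<mu> = measure_of X (sets (metric_borel X d))
     (\<lambda>A. SUP B \<in> {B \<in> sets (metric_borel X d). B \<subseteq> A}. ennreal (\<mu> B))"

definition signed_integral ::
    "'a set \<Rightarrow> ('a \<Rightarrow> 'a \<Rightarrow> real) \<Rightarrow> ('a set \<Rightarrow> real) \<Rightarrow> ('a \<Rightarrow> real) \<Rightarrow> real" where
  "signed_integral X d \<mu> f =
     (\<integral>x. f x \<partial>upper_variation X d \<mu>) - (\<integral>x. f x \<partial>upper_variation X d (\<lambda>A. - \<mu> A))"

text \<open>On a finite space the integral is the expected finite sum.\<close>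

lemma sets_metric_borel_finite:
  assumes "Metric_space X d" "finite X"
  shows "sets (metric_borel X d) = Pow X" "space (metric_borel X d) = X"
proof -
  interpret Metric_space X d by fact
  have "openin mtopology U" if "U \<subseteq> X" for U
  proof -
    have "closedin mtopology (X - U)"
      using Hausdorff_space_mtopology assms(2)
      by (metis Diff_subset Hausdorff_imp_t1_space finite_Diff t1_space_closedin_finite topspace_mtopology)
    then show ?thesis using that
      by (metis double_diff openin_closedin_eq topspace_mtopology order_refl)
  qed
  then have *: "{U. openin mtopology U} = Pow X"
    using openin_subset by fastforce
  show "sets (metric_borel X d) = Pow X" "space (metric_borel X d) = X"
    unfolding metric_borel_def * by (auto simp: sigma_algebra.sigma_sets_eq sigma_algebra_Pow)
qed

lemma signed_measure_finite_sum:
  assumes "Metric_space X d" "finite X" "\<mu> \<in> signed_measures X d" "A \<subseteq> X"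
  shows "\<mu> A = (\<Sum>x\<in>A. \<mu> {x})"
proof -
  have add: "\<mu> (insert x F) = \<mu> {x} + \<mu> F" if "x \<notin> F" "insert x F \<subseteq> X" for x F
  proof -
    let ?A = "\<lambda>i::nat. if i = 0 then {x} else if i = 1 then F else {}"
    have "range ?A \<subseteq> sets (metric_borel X d)"
      using that unfolding sets_metric_borel_finite(1)[OF assms(1,2)] by (auto split: if_splits)
    moreover have "disjoint_family ?A"
      using that by (auto simp: disjoint_family_on_def split: if_splits)
    ultimately have "(\<lambda>i. \<mu> (?A i)) sums \<mu> (\<Union>i. ?A i)"
      using assms(3) unfolding signed_measures_def by blast
    moreover have "(\<Union>i. ?A i) = insert x F" by (auto split: if_splits)
    moreover have "(\<lambda>i. \<mu> (?A i)) sums (\<Sum>i\<in>{0,1}. \<mu> (?A i))"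
      by (rule sums_finite) (use assms(3) in \<open>auto simp: signed_measures_def\<close>)
    ultimately show ?thesis by (auto dest: sums_unique2)
  qed
  have "finite A" by (rule finite_subset[OF assms(4,2)])
  then show ?thesis using assms(4)
  proof (induction A)
    case empty then show ?case using assms(3) by (auto simp: signed_measures_def)
  next
    case (insert x F)
    have "\<mu> (insert x F) = \<mu> {x} + \<mu> F" by (rule add[OF insert.hyps(2) insert.prems])
    also have "\<mu> F = (\<Sum>x\<in>F. \<mu> {x})" using insert by blast
    finally show ?case by (simp only: sum.insert[OF insert.hyps])
  qed
qed

lemma integral_upper_variation:
  assumes "finite X" and sb: "sets (metric_borel X d) = Pow X"
    and fs: "\<And>A. A \<subseteq> X \<Longrightarrow> \<mu> A = (\<Sum>x\<in>A. \<mu> {x})"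
  shows "(\<integral>x. f x \<partial>upper_variation X d \<mu>) = (\<Sum>x\<in>X. f x * max 0 (\<mu> {x}))"
proof -
  let ?m = "\<lambda>A. SUP B \<in> {B \<in> sets (metric_borel X d). B \<subseteq> A}. ennreal (\<mu> B)"
  let ?P = "point_measure X (\<lambda>x. ennreal (max 0 (\<mu> {x})))"
  have m: "?m A = emeasure ?P A" if "A \<subseteq> X" for A
  proof -
    have fA: "finite A" by (rule finite_subset[OF that assms(1)])
    have P: "emeasure ?P A = ennreal (\<Sum>x\<in>A. max 0 (\<mu> {x}))"
      using that fA by (simp add: emeasure_point_measure_finite2 assms(1))
    let ?B = "{x\<in>A. \<mu> {x} > 0}"
    have B: "\<mu> ?B = (\<Sum>x\<in>A. max 0 (\<mu> {x}))"
    proof -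
      have "\<mu> ?B = (\<Sum>x\<in>?B. \<mu> {x})" by (rule fs) (use that in auto)
      also have "\<dots> = (\<Sum>x\<in>?B. max 0 (\<mu> {x}))" by (rule sum.cong) auto
      also have "\<dots> = (\<Sum>x\<in>A. max 0 (\<mu> {x}))"
        by (rule sum.mono_neutral_left) (use fA in auto)
      finally show ?thesis .
    qed
    show ?thesis
    proof (rule antisym)
      show "?m A \<le> emeasure ?P A" unfolding P
      proof (rule SUP_least, rule ennreal_leI)
        fix C assume C: "C \<in> {B \<in> sets (metric_borel X d). B \<subseteq> A}"
        have "\<mu> C = (\<Sum>x\<in>C. \<mu> {x})" using C that by (intro fs) auto
        also have "\<dots> \<le> (\<Sum>x\<in>C. max 0 (\<mu> {x}))" by (intro sum_mono) auto
        also have "\<dots> \<le> (\<Sum>x\<in>A. max 0 (\<mu> {x}))" using C fA by (intro sum_mono2) auto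
        finally show "\<mu> C \<le> (\<Sum>x\<in>A. max 0 (\<mu> {x}))" .
      qed
      show "emeasure ?P A \<le> ?m A" unfolding P B[symmetric]
        by (rule SUP_upper) (use that sb in auto)
    qed
  qed
  have "upper_variation X d \<mu> = measure_of X (Pow X) (emeasure ?P)"
    unfolding upper_variation_def sb
  proof (rule measure_of_eq)
    fix A assume "A \<in> sigma_sets X (Pow X)"
    then have "A \<subseteq> X" by (metis sigma_sets_into_sp order_refl)
    then show "(SUP B \<in> {B \<in> Pow X. B \<subseteq> A}. ennreal (\<mu> B)) = emeasure ?P A"
      using m sb by simp
  qed auto
  also have "\<dots> = ?P" 
    using measure_of_of_measure[of ?P] by (simp add: space_point_measure sets_point_measure)
  finally show ?thesis
    by (simp add: lebesgue_integral_point_measure_finite assms(1) mult.commute)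
qed

lemma signed_integral_finite:
  assumes "Metric_space X d" "finite X" "\<mu> \<in> signed_measures X d"
  shows "signed_integral X d \<mu> f = (\<Sum>x\<in>X. f x * \<mu> {x})"
proof -
  note sb = sets_metric_borel_finite(1)[OF assms(1,2)]
  note fs = signed_measure_finite_sum[OF assms]
  have fs': "- \<mu> A = (\<Sum>x\<in>A. - \<mu> {x})" if "A \<subseteq> X" for A
    unfolding sum_negf using fs[OF that] by (rule arg_cong)
  have "signed_integral X d \<mu> f = (\<Sum>x\<in>X. f x * max 0 (\<mu> {x})) - (\<Sum>x\<in>X. f x * max 0 (- \<mu> {x}))"
    unfolding signed_integral_def
    using integral_upper_variation[OF assms(2) sb fs, of f]
      integral_upper_variation[OF assms(2) sb, of "\<lambda>A. - \<mu> A" f, OF fs'] by simp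
  also have "\<dots> = (\<Sum>x\<in>X. f x * \<mu> {x})"
    unfolding sum_subtractf[symmetric] by (rule sum.cong) (auto simp: max_def)
  finally show ?thesis .
qed

section \<open>Energy, invariant measures and the quasihypermetric property\<close>

definition energy :: "'a set \<Rightarrow> ('a \<Rightarrow> 'a \<Rightarrow> real) \<Rightarrow> ('a set \<Rightarrow> real) \<Rightarrow> real" where
  "energy X d \<mu> = signed_integral X d \<mu> (\<lambda>y. signed_integral X d \<mu> (\<lambda>x. d x y))"

definition M_sup :: "'a set \<Rightarrow> ('a \<Rightarrow> 'a \<Rightarrow> real) \<Rightarrow> ereal" where
  "M_sup X d = (SUP \<mu> \<in> signed_measures_1 X d. ereal (energy X d \<mu>))"

definition M_plus_sup :: "'a set \<Rightarrow> ('a \<Rightarrow> 'a \<Rightarrow> real) \<Rightarrow> ereal" where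
  "M_plus_sup X d = (SUP \<mu> \<in> prob_measures X d. ereal (energy X d \<mu>))"

definition potential :: "'a set \<Rightarrow> ('a \<Rightarrow> 'a \<Rightarrow> real) \<Rightarrow> ('a set \<Rightarrow> real) \<Rightarrow> 'a \<Rightarrow> real" where
  "potential X d \<mu> x = signed_integral X d \<mu> (\<lambda>y. d x y)"

definition d_invariant :: "'a set \<Rightarrow> ('a \<Rightarrow> 'a \<Rightarrow> real) \<Rightarrow> ('a set \<Rightarrow> real) \<Rightarrow> bool" where
  "d_invariant X d \<mu> \<longleftrightarrow> \<mu> \<in> signed_measures X d \<and> (\<exists>c. \<forall>x\<in>X. potential X d \<mu> x = c)"

definition quasihypermetric :: "'a set \<Rightarrow> ('a \<Rightarrow> 'a \<Rightarrow> real) \<Rightarrow> bool" where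
  "quasihypermetric X d \<longleftrightarrow>
     (\<forall>(n::nat) (x::nat \<Rightarrow> 'a) (\<alpha>::nat \<Rightarrow> real).
        (\<forall>i\<in>{1..n}. x i \<in> X) \<and> (\<Sum>i=1..n. \<alpha> i) = 0 \<longrightarrow>
        (\<Sum>i=1..n. \<Sum>j=1..n. \<alpha> i * \<alpha> j * d (x i) (x j)) \<le> 0)"

definition strictly_quasihypermetric :: "'a set \<Rightarrow> ('a \<Rightarrow> 'a \<Rightarrow> real) \<Rightarrow> bool" where
  "strictly_quasihypermetric X d \<longleftrightarrow> quasihypermetric X d \<and>
     (\<forall>\<mu> \<in> signed_measures_0 X d. energy X d \<mu> = 0 \<longrightarrow> \<mu> = (\<lambda>A. 0))"

section \<open>Euclidean spaces and S-embeddings\<close>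

text \<open>
  The dimension is quantified inside the theorem, so \<open>\<real>\<^sup>m\<close> is realised as the set of finitely
  supported real sequences vanishing from index \<open>m\<close> on. This type is a real vector space, hence
  the library notions of convex hull and affine dependence apply. Its type class norm is the
  \<open>\<ell>\<^sup>1\<close>-norm, however, and is not used; \<open>euclid_norm\<close> is the euclidean norm.
\<close>

definition euclid :: "nat \<Rightarrow> (nat \<Rightarrow>\<^sub>0 real) set" where
  "euclid m = {v. \<forall>i\<ge>m. Poly_Mapping.lookup v i = 0}"

definition euclid_norm :: "nat \<Rightarrow> (nat \<Rightarrow>\<^sub>0 real) \<Rightarrow> real" where
  "euclid_norm m v = sqrt (\<Sum>i<m. (Poly_Mapping.lookup v i)\<^sup>2)"

definition euclid_sphere :: "nat \<Rightarrow> (nat \<Rightarrow>\<^sub>0 real) \<Rightarrow> real \<Rightarrow> (nat \<Rightarrow>\<^sub>0 real) set" where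
  "euclid_sphere m z r = {y \<in> euclid m. euclid_norm m (y - z) = r}"

definition S_embedding ::
    "'a set \<Rightarrow> ('a \<Rightarrow> 'a \<Rightarrow> real) \<Rightarrow> nat \<Rightarrow> ('a \<Rightarrow> (nat \<Rightarrow>\<^sub>0 real)) \<Rightarrow> bool" where
  "S_embedding X d m \<phi> \<longleftrightarrow> \<phi> ` X \<subseteq> euclid m \<and>
     (\<forall>x\<in>X. \<forall>y\<in>X. (euclid_norm m (\<phi> x - \<phi> y))\<^sup>2 = d x y)"

definition minimal_S_embedding ::
    "'a set \<Rightarrow> ('a \<Rightarrow> 'a \<Rightarrow> real) \<Rightarrow> nat \<Rightarrow> ('a \<Rightarrow> (nat \<Rightarrow>\<^sub>0 real)) \<Rightarrow> bool" where
  "minimal_S_embedding X d m \<phi> \<longleftrightarrow> S_embedding X d m \<phi> \<and>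
     (\<forall>k \<psi>. S_embedding X d k \<psi> \<longrightarrow> m \<le> k)"

definition lies_on_sphere :: "nat \<Rightarrow> (nat \<Rightarrow>\<^sub>0 real) set \<Rightarrow> bool" where
  "lies_on_sphere m S \<longleftrightarrow> (\<exists>z\<in>euclid m. \<exists>r\<ge>0. S \<subseteq> euclid_sphere m z r)"

definition lies_on_sphere_centred_in_hull :: "nat \<Rightarrow> (nat \<Rightarrow>\<^sub>0 real) set \<Rightarrow> bool" where
  "lies_on_sphere_centred_in_hull m S \<longleftrightarrow>
     (\<exists>z\<in>euclid m. \<exists>r\<ge>0. S \<subseteq> euclid_sphere m z r \<and> z \<in> convex hull S)"

end

theory Submission
  imports Defs
begin

text \<open>
  A signed measure on a finite space is a weight \<open>w\<close> on its points. If \<open>\<phi>\<close> is an S-embedding and \<open>w\<close> has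
  mass \<open>1\<close> and barycentre \<open>z = \<Sum>\<^sub>x w(x) \<phi>(x)\<close>, then \<open>d\<^sub>w(x) = \<parallel>\<phi>(x) - z\<parallel>\<^sup>2 + const\<close>, so \<open>w\<close> is
  \<open>d\<close>-invariant iff \<open>\<phi>(X)\<close> lies on a sphere centred at \<open>z\<close>; if \<open>w\<close> has mass \<open>0\<close>, its energy is
  \<open>- 2\<parallel>\<Sum>\<^sub>x w(x) \<phi>(x)\<parallel>\<^sup>2\<close>, which ties strictness to affine independence. The energy is concave on
  weights of mass \<open>1\<close>, and its maximisers are exactly the invariant weights. If there are none,
  the Fredholm alternative gives a direction of mass \<open>0\<close> along which the energy grows linearly.
  S-embeddings exist by Schoenberg's theorem, here via a Cholesky factorisation.
\<close>

section \<open>Linear algebra over finite index sets\<close>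

text \<open>Induction on the columns, for all right-hand sides at once. When a certificate
  \<open>u\<close> against \<open>b\<close> fails to annihilate the new column, a multiple of that
  column is moved to the right-hand side so that \<open>u\<close> no longer obstructs; any
  certificate \<open>v\<close> against the new system is then corrected by a multiple of
  \<open>u\<close>.\<close>

lemma fredholm_alternative:
  fixes A :: "'j \<Rightarrow> 'i \<Rightarrow> real" and b :: "'j \<Rightarrow> real"
  assumes "finite I" "finite J"
  shows "(\<exists>w. \<forall>j\<in>J. (\<Sum>i\<in>I. A j i * w i) = b j) \<or>
    (\<exists>u. (\<forall>i\<in>I. (\<Sum>j\<in>J. u j * A j i) = 0) \<and> (\<Sum>j\<in>J. u j * b j) \<noteq> 0)"
  using assms(1)
proof (induction I arbitrary: b)
  case empty
  show ?case
  proof (cases "\<forall>j\<in>J. b j = 0")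
    case False
    then obtain j where "j \<in> J" "b j \<noteq> 0" by blast
    then have "(\<Sum>k\<in>J. (if k = j then 1 else 0) * b k) \<noteq> 0"
      using assms(2) by (simp add: if_distrib [of "\<lambda>t. t * _"] cong: if_cong)
    then show ?thesis by (intro disjI2 exI [of _ "\<lambda>k. if k = j then 1 else 0"]) simp
  qed simp
next
  case (insert a I)
  let ?dual = "\<lambda>b. \<exists>u. (\<forall>i\<in>I. (\<Sum>j\<in>J. u j * A j i) = 0) \<and> (\<Sum>j\<in>J. u j * b j) \<noteq> 0"
  have lift: "\<exists>w. \<forall>j\<in>J. (\<Sum>i\<in>insert a I. A j i * w i) = b j"
    if "\<forall>j\<in>J. (\<Sum>i\<in>I. A j i * w i) = b j - t * A j a" for w t
  proof (intro exI [of _ "w(a := t)"] ballI)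
    fix j assume "j \<in> J"
    have "(\<Sum>i\<in>I. A j i * (w(a := t)) i) = (\<Sum>i\<in>I. A j i * w i)"
      using insert.hyps(2) by (intro sum.cong) auto
    then show "(\<Sum>i\<in>insert a I. A j i * (w(a := t)) i) = b j"
      using insert.hyps that \<open>j \<in> J\<close> by simp
  qed
  show ?case
  proof (cases "\<exists>w. \<forall>j\<in>J. (\<Sum>i\<in>I. A j i * w i) = b j")
    case True
    then show ?thesis using lift [where t=0] by auto
  next
    case False
    then obtain u where u: "\<forall>i\<in>I. (\<Sum>j\<in>J. u j * A j i) = 0" "(\<Sum>j\<in>J. u j * b j) \<noteq> 0"
      using insert.IH by blast
    define p where "p = (\<Sum>j\<in>J. u j * A j a)"
    show ?thesis
    proof (cases "p = 0")
      case True
      then show ?thesis using u p_def by auto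
    next
      case p: False
      \<comment> \<open>The one coefficient of column \<open>a\<close> for which \<open>u\<close>
        pairs to zero with the remaining right-hand side \<open>b'\<close>.\<close>
      define t where "t = (\<Sum>j\<in>J. u j * b j) / p"
      define b' where "b' = (\<lambda>j. b j - t * A j a)"
      show ?thesis
      proof (cases "\<exists>w. \<forall>j\<in>J. (\<Sum>i\<in>I. A j i * w i) = b' j")
        case True
        then show ?thesis using lift unfolding b'_def by blast
      next
        case False
        then obtain v where v: "\<forall>i\<in>I. (\<Sum>j\<in>J. v j * A j i) = 0" "(\<Sum>j\<in>J. v j * b' j) \<noteq> 0"
          using insert.IH by blast
        define s where "s = (\<Sum>j\<in>J. v j * A j a) / p"
        \<comment> \<open>Annihilates column \<open>a\<close> by the choice of \<open>s\<close>, and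
          the columns in \<open>I\<close> because \<open>u\<close> and \<open>v\<close> do. Since
          \<open>u\<close> annihilates \<open>b'\<close>, the pairing of \<open>x\<close> with
          \<open>b'\<close> is that of \<open>v\<close>, hence nonzero.\<close>
        define x where "x = (\<lambda>j. v j - s * u j)"
        have x: "(\<Sum>j\<in>J. x j * f j) = (\<Sum>j\<in>J. v j * f j) - s * (\<Sum>j\<in>J. u j * f j)" for f
          by (simp add: x_def algebra_simps sum_subtractf sum_distrib_left)
        have b': "(\<Sum>j\<in>J. y j * b' j) = (\<Sum>j\<in>J. y j * b j) - t * (\<Sum>j\<in>J. y j * A j a)" for y
          by (simp add: b'_def algebra_simps sum_subtractf sum_distrib_left)
        have xa: "(\<Sum>j\<in>J. x j * A j a) = 0"
          using p by (simp add: x s_def flip: p_def)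
        have "(\<Sum>j\<in>J. u j * b' j) = 0"
          using p by (simp add: b' t_def flip: p_def)
        then have "(\<Sum>j\<in>J. x j * b' j) \<noteq> 0"
          using v(2) by (simp add: x)
        then have "(\<Sum>j\<in>J. x j * b j) \<noteq> 0"
          by (simp add: b' xa)
        moreover have "\<forall>i\<in>insert a I. (\<Sum>j\<in>J. x j * A j i) = 0"
          using xa u(1) v(1) by (auto simp: x)
        ultimately show ?thesis by blast
      qed
    qed
  qed
qed

text \<open>Split off one row at a time by a Schur complement.\<close>

lemma positive_semidefinite_imp_gram:
  fixes G :: "'a \<Rightarrow> 'a \<Rightarrow> real"
  assumes "finite X"
    and "\<And>x y. x \<in> X \<Longrightarrow> y \<in> X \<Longrightarrow> G x y = G y x"
    and "\<And>c. 0 \<le> (\<Sum>x\<in>X. \<Sum>y\<in>X. c x * c y * G x y)"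
  shows "\<exists>(m::nat) f. \<forall>x\<in>X. \<forall>y\<in>X. G x y = (\<Sum>i<m. f x i * f y i)"
  using assms
proof (induction X arbitrary: G)
  case empty
  then show ?case by simp
next
  case (insert a X)
  define g where "g = G a a"
  \<comment> \<open>The form as a quadratic polynomial in the coefficient \<open>t\<close> at the
    new point \<open>a\<close>.\<close>
  have expand: "(\<Sum>x\<in>insert a X. \<Sum>y\<in>insert a X. (c(a := t)) x * (c(a := t)) y * G x y) =
      (\<Sum>x\<in>X. \<Sum>y\<in>X. c x * c y * G x y) + 2 * t * (\<Sum>x\<in>X. c x * G a x) + t\<^sup>2 * g" for c t
  proof -
    have on_X: "(\<Sum>x\<in>X. h x ((c(a := t)) x)) = (\<Sum>x\<in>X. h x (c x))" for h :: "'a \<Rightarrow> real \<Rightarrow> real"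
      using insert.hyps(2) by (intro sum.cong) auto
    have sym: "(\<Sum>x\<in>X. c x * t * G x a) = t * (\<Sum>x\<in>X. c x * G a x)"
      using insert.prems(1)
      by (auto simp: sum_distrib_left intro!: sum.cong)
    have "(\<Sum>x\<in>insert a X. \<Sum>y\<in>insert a X. (c(a := t)) x * (c(a := t)) y * G x y) =
      t * t * g + (\<Sum>y\<in>X. t * c y * G a y) + (\<Sum>x\<in>X. c x * t * G x a + (\<Sum>y\<in>X. c x * c y * G x y))"
      using insert.hyps on_X [of "\<lambda>y r. t * r * G a y"]
        on_X [of "\<lambda>x r. r * t * G x a + (\<Sum>y\<in>X. r * (c(a := t)) y * G x y)"]
        on_X [of "\<lambda>y r. _ * r * G _ y"]
      by (simp add: g_def del: fun_upd_apply) (simp add: on_X)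
    moreover have "(\<Sum>y\<in>X. t * c y * G a y) = t * (\<Sum>x\<in>X. c x * G a x)"
      by (simp add: sum_distrib_left mult.assoc)
    ultimately show ?thesis
      by (simp add: sum.distrib sym power2_eq_square)
  qed
  have nonneg: "0 \<le> (\<Sum>x\<in>X. \<Sum>y\<in>X. c x * c y * G x y) + 2 * t * (\<Sum>x\<in>X. c x * G a x) + t\<^sup>2 * g" for c t
    using insert.prems(2) [of "c(a := t)"] unfolding expand .
  have g: "0 \<le> g"
    using nonneg [of "\<lambda>_. 0" 1] by simp
  show ?case
  proof (cases "g = 0")
    case True
    \<comment> \<open>With \<open>g = 0\<close> the polynomial is affine in \<open>t\<close>, so its
      nonnegativity for all \<open>t\<close> forces the slope to vanish.\<close>
    have zero: "G a x = 0" if "x \<in> X" for x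
    proof (rule ccontr)
      assume nz: "G a x \<noteq> 0"
      define c where "c = (\<lambda>y. if y = x then 1 else 0 :: real)"
      have 1: "(\<Sum>y\<in>X. c y * G a y) = G a x"
        using \<open>x \<in> X\<close> insert.hyps(1)
        by (simp add: c_def if_distrib [of "\<lambda>t. t * _"] cong: if_cong)
      have "0 \<le> (\<Sum>x\<in>X. \<Sum>y\<in>X. c x * c y * G x y) + 2 * t * G a x" for t
        using nonneg [of c t] True by (simp add: 1)
      then have "0 \<le> (\<Sum>x\<in>X. \<Sum>y\<in>X. c x * c y * G x y) + t" for t
        using nz by (elim meta_allE [of _ "t / (2 * G a x)"]) simp
      from this [of "- (\<Sum>x\<in>X. \<Sum>y\<in>X. c x * c y * G x y) - 1"] show False by simp
    qed
    have "0 \<le> (\<Sum>x\<in>X. \<Sum>y\<in>X. c x * c y * G x y)" for c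
      using nonneg [of c 0] by simp
    then obtain m :: nat and f where f: "\<forall>x\<in>X. \<forall>y\<in>X. G x y = (\<Sum>i<m. f x i * f y i)"
      using insert.IH [of G] insert.prems(1) by auto
    have "\<forall>x\<in>insert a X. \<forall>y\<in>insert a X.
        G x y = (\<Sum>i<m. (f(a := \<lambda>_. 0)) x i * (f(a := \<lambda>_. 0)) y i)"
      using f zero True insert.prems(1) insert.hyps(2) by (auto simp: g_def)
    then show ?thesis by blast
  next
    case False
    with g have pos: "0 < g" by simp
    define H where "H = (\<lambda>x y. G x y - G a x * G a y / g)"
    have "0 \<le> (\<Sum>x\<in>X. \<Sum>y\<in>X. c x * c y * H x y)" for c
    proof -
      let ?l = "\<Sum>x\<in>X. c x * G a x"
      have "(\<Sum>x\<in>X. \<Sum>y\<in>X. c x * c y * (G a x * G a y / g)) = ?l * ?l / g"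
        by (simp add: sum_product sum_divide_distrib mult_ac)
      then have "(\<Sum>x\<in>X. \<Sum>y\<in>X. c x * c y * H x y) =
          (\<Sum>x\<in>X. \<Sum>y\<in>X. c x * c y * G x y) - ?l * ?l / g"
        by (simp add: H_def right_diff_distrib sum_subtractf)
      \<comment> \<open>The value of the polynomial at its minimiser
        \<open>t = - ?l / g\<close>.\<close>
      also have "\<dots> = (\<Sum>x\<in>X. \<Sum>y\<in>X. c x * c y * G x y) + 2 * (- ?l / g) * ?l + (- ?l / g)\<^sup>2 * g"
        using pos by (simp add: field_simps power2_eq_square)
      finally show ?thesis using nonneg [of c "- ?l / g"] by simp
    qed
    then obtain m :: nat and f where f: "\<forall>x\<in>X. \<forall>y\<in>X. H x y = (\<Sum>i<m. f x i * f y i)"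
      using insert.IH [of H] insert.prems(1) by (auto simp: H_def mult.commute)
    \<comment> \<open>The new coordinate, of index \<open>m\<close>, carries the rank-one term
      removed from \<open>G\<close>; the others vanish at \<open>a\<close> because row
      \<open>a\<close> of \<open>H\<close> is zero.\<close>
    define h where "h = (\<lambda>x i. if i = m then G a x / sqrt g else if x = a then 0 else f x i)"
    have h: "(\<Sum>i<Suc m. h x i * h y i) =
        (if x = a \<or> y = a then 0 else \<Sum>i<m. f x i * f y i) + G a x * G a y / g" for x y
      using pos by (simp add: h_def)
    have "G x y = (\<Sum>i<Suc m. h x i * h y i)" if "x \<in> insert a X" "y \<in> insert a X" for x y
    proof (cases "x = a \<or> y = a")
      case True
      then show ?thesis
        unfolding h using pos that insert.prems(1) [of x y] by (auto simp: g_def)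
    next
      case False
      then show ?thesis
        unfolding h using f that by (simp add: H_def flip: f)
    qed
    then show ?thesis by blast
  qed
qed

section \<open>The euclidean inner product\<close>

text \<open>Sums the first \<open>m\<close> coordinates, as \<open>euclid_norm\<close> does, so it
  is semidefinite on the whole type and definite on \<open>euclid m\<close>.\<close>

definition euclid_inner :: "nat \<Rightarrow> (nat \<Rightarrow>\<^sub>0 real) \<Rightarrow> (nat \<Rightarrow>\<^sub>0 real) \<Rightarrow> real" where
  "euclid_inner m u v = (\<Sum>i<m. Poly_Mapping.lookup u i * Poly_Mapping.lookup v i)"

lemma euclid_norm_nonneg: "0 \<le> euclid_norm m v"
  by (simp add: euclid_norm_def sum_nonneg)

lemma euclid_norm_sq: "(euclid_norm m v)\<^sup>2 = euclid_inner m v v"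
  by (simp add: euclid_norm_def euclid_inner_def sum_nonneg power2_eq_square)

lemma euclid_inner_nonneg: "0 \<le> euclid_inner m v v"
  by (simp add: euclid_inner_def sum_nonneg)

lemma euclid_inner_commute: "euclid_inner m u v = euclid_inner m v u"
  by (simp add: euclid_inner_def mult.commute)

lemma lookup_scaleR: "Poly_Mapping.lookup (c *\<^sub>R v) i = c * Poly_Mapping.lookup v i"
  by (simp add: scaleR_poly_mapping_def)

lemma lookup_sum_scaleR:
  "Poly_Mapping.lookup (\<Sum>x\<in>X. c x *\<^sub>R f x) i = (\<Sum>x\<in>X. c x * Poly_Mapping.lookup (f x) i)"
  by (induction X rule: infinite_finite_induct) (auto simp: lookup_add lookup_scaleR)

lemma euclid_inner_sum_right:
  "euclid_inner m u (\<Sum>x\<in>X. c x *\<^sub>R f x) = (\<Sum>x\<in>X. c x * euclid_inner m u (f x))"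
  unfolding euclid_inner_def lookup_sum_scaleR sum_distrib_left
  by (subst sum.swap) (simp add: mult_ac)

lemma euclid_inner_diff_self:
  "euclid_inner m (u - v) (u - v) = euclid_inner m u u + euclid_inner m v v - 2 * euclid_inner m u v"
  by (simp add: euclid_inner_def lookup_minus algebra_simps sum.distrib sum_subtractf sum_distrib_left)

lemma euclid_inner_self_eq_0:
  assumes "v \<in> euclid m" "euclid_inner m v v = 0"
  shows "v = 0"
proof (rule poly_mapping_eqI)
  fix i
  have "\<forall>i\<in>{..<m}. Poly_Mapping.lookup v i * Poly_Mapping.lookup v i = 0"
    using assms(2) unfolding euclid_inner_def
    by (subst (asm) sum_nonneg_eq_0_iff) auto
  then show "Poly_Mapping.lookup v i = Poly_Mapping.lookup 0 i"
    using assms(1) by (cases "i < m") (auto simp: euclid_def)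
qed

lemma euclid_sum_scaleR: "f ` X \<subseteq> euclid m \<Longrightarrow> (\<Sum>x\<in>X. c x *\<^sub>R f x) \<in> euclid m"
  by (auto simp: euclid_def lookup_sum_scaleR intro!: sum.neutral)

section \<open>Signed measures on a finite space as weights\<close>

text \<open>The value \<open>0\<close> on other sets follows the convention of
  \<open>signed_measures\<close>. A measure determines its weight on \<open>X\<close> and not
  beyond.\<close>

definition weight_measure :: "'a set \<Rightarrow> ('a \<Rightarrow> real) \<Rightarrow> 'a set \<Rightarrow> real" where
  "weight_measure X w A = (if A \<subseteq> X then sum w A else 0)"

locale finite_quasihypermetric_space = Metric_space X d
  for X :: "'a set" and d :: "'a \<Rightarrow> 'a \<Rightarrow> real" +
  assumes finite_space: "finite X" and space_nonempty: "X \<noteq> {}"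
    and quasihypermetric: "quasihypermetric X d"
begin

lemma borel_sets: "sets (metric_borel X d) = Pow X"
  by (rule sets_metric_borel_finite) (use finite_space Metric_space_axioms in auto)

text \<open>A finite combination of point masses; for each of these, countable additivity holds
  because at most one member of a disjoint family contains the point.\<close>

lemma weight_measure_in_signed_measures: "weight_measure X w \<in> signed_measures X d"
proof -
  have "(\<lambda>i. weight_measure X w (A i)) sums weight_measure X w (\<Union>i. A i)"
    if A: "range A \<subseteq> Pow X" "disjoint_family A" for A :: "nat \<Rightarrow> 'a set"
  proof -
    have eq: "weight_measure X w B = (\<Sum>x\<in>X. w x * indicator B x)" if "B \<subseteq> X" for B
      using that finite_space
      by (simp add: weight_measure_def indicator_def if_distrib [of "\<lambda>t. _ * t"] sum.If_cases
          Int_absorb1 cong: if_cong)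
    have single: "(\<lambda>i. indicator (A i) x :: real) sums indicator (\<Union>i. A i) x" for x
    proof (cases "x \<in> (\<Union>i. A i)")
      case True
      then obtain j where j: "x \<in> A j" by blast
      then have "(\<lambda>i. indicator (A i) x :: real) = (\<lambda>i. if i = j then 1 else 0)"
        using A(2) by (fastforce simp: disjoint_family_on_def indicator_def)
      then show ?thesis using True sums_single [of j "\<lambda>_. 1 :: real"] by simp
    next
      case False
      then show ?thesis by simp
    qed
    have "(\<lambda>i. \<Sum>x\<in>X. w x * indicator (A i) x) sums (\<Sum>x\<in>X. w x * indicator (\<Union>i. A i) x)"
      by (intro sums_sum sums_mult single)
    moreover have "A i \<subseteq> X" for i using A(1) by auto
    moreover have "(\<Union>i. A i) \<subseteq> X" using A(1) by auto
    ultimately show ?thesis by (simp add: eq)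
  qed
  then show ?thesis
    by (auto simp: signed_measures_def borel_sets weight_measure_def)
qed

lemma weight_measure_singleton: "x \<in> X \<Longrightarrow> weight_measure X w {x} = w x"
  by (simp add: weight_measure_def)

lemma weight_measure_cong: "(\<And>x. x \<in> X \<Longrightarrow> u x = v x) \<Longrightarrow> weight_measure X u = weight_measure X v"
  by (auto simp: weight_measure_def fun_eq_iff intro!: sum.cong)

lemma signed_measure_eq_weight_measure:
  assumes "\<mu> \<in> signed_measures X d"
  shows "\<mu> = weight_measure X (\<lambda>x. \<mu> {x})"
proof
  fix A
  show "\<mu> A = weight_measure X (\<lambda>x. \<mu> {x}) A"
  proof (cases "A \<subseteq> X")
    case True
    then show ?thesis
      using signed_measure_finite_sum [OF Metric_space_axioms finite_space assms True]
      by (simp add: weight_measure_def)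
  next
    case False
    then show ?thesis using assms by (auto simp: weight_measure_def signed_measures_def borel_sets)
  qed
qed

lemma signed_measures_eq: "signed_measures X d = range (weight_measure X)"
  using signed_measure_eq_weight_measure weight_measure_in_signed_measures by blast

lemma signed_measures_0_eq: "signed_measures_0 X d = weight_measure X ` {w. sum w X = 0}"
  by (auto simp: signed_measures_0_def signed_measures_eq weight_measure_def)

lemma signed_measures_1_eq: "signed_measures_1 X d = weight_measure X ` {w. sum w X = 1}"
  by (auto simp: signed_measures_1_def signed_measures_eq weight_measure_def)

lemma prob_measures_eq:
  "prob_measures X d = weight_measure X ` {w. (\<forall>x\<in>X. 0 \<le> w x) \<and> sum w X = 1}" (is "?P = ?W")
proof
  show "?P \<subseteq> ?W"
  proof
    fix \<mu> assume \<mu>: "\<mu> \<in> ?P"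
    then obtain w where w: "\<mu> = weight_measure X w" "sum w X = 1"
      by (auto simp: prob_measures_def signed_measures_1_eq)
    have "0 \<le> w x" if "x \<in> X" for x
    proof -
      have "0 \<le> \<mu> {x}" using \<mu> that by (auto simp: prob_measures_def borel_sets)
      then show ?thesis using that by (simp add: w weight_measure_singleton)
    qed
    with w show "\<mu> \<in> ?W" by blast
  qed
  show "?W \<subseteq> ?P"
    by (auto simp: prob_measures_def signed_measures_1_eq borel_sets weight_measure_def
        intro!: sum_nonneg) blast
qed

section \<open>Mutual energy and potentials of weights\<close>

definition dist_form :: "('a \<Rightarrow> real) \<Rightarrow> ('a \<Rightarrow> real) \<Rightarrow> real" where
  "dist_form u v = (\<Sum>x\<in>X. \<Sum>y\<in>X. u x * v y * d x y)"

definition weight_potential :: "('a \<Rightarrow> real) \<Rightarrow> 'a \<Rightarrow> real" where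
  "weight_potential w x = (\<Sum>y\<in>X. w y * d x y)"

definition invariant_weight :: "('a \<Rightarrow> real) \<Rightarrow> bool" where
  "invariant_weight w \<longleftrightarrow> (\<exists>c. \<forall>x\<in>X. weight_potential w x = c)"

lemma signed_integral_weight_measure:
  "signed_integral X d (weight_measure X w) f = (\<Sum>x\<in>X. f x * w x)"
  using signed_integral_finite [OF Metric_space_axioms finite_space weight_measure_in_signed_measures]
  by (simp add: weight_measure_singleton)

lemma energy_weight_measure: "energy X d (weight_measure X w) = dist_form w w"
  by (simp add: energy_def signed_integral_weight_measure dist_form_def sum_distrib_left
      sum_distrib_right commute mult_ac)

lemma potential_weight_measure: "potential X d (weight_measure X w) x = weight_potential w x"
  by (simp add: potential_def signed_integral_weight_measure weight_potential_def mult.commute)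

lemma d_invariant_weight_measure: "d_invariant X d (weight_measure X w) \<longleftrightarrow> invariant_weight w"
  by (simp add: d_invariant_def potential_weight_measure weight_measure_in_signed_measures
      invariant_weight_def)

lemma M_sup_eq: "M_sup X d = (SUP w\<in>{w. sum w X = 1}. ereal (dist_form w w))"
  by (simp add: M_sup_def signed_measures_1_eq image_image energy_weight_measure)

lemma M_plus_sup_eq:
  "M_plus_sup X d = (SUP w\<in>{w. (\<forall>x\<in>X. 0 \<le> w x) \<and> sum w X = 1}. ereal (dist_form w w))"
  by (simp add: M_plus_sup_def prob_measures_eq image_image energy_weight_measure)

lemma ex_invariant_signed_measure:
  "(\<exists>\<mu>\<in>signed_measures_1 X d. d_invariant X d \<mu>) \<longleftrightarrow> (\<exists>w. sum w X = 1 \<and> invariant_weight w)"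
  by (auto simp: signed_measures_1_eq d_invariant_weight_measure)

lemma ex_invariant_prob_measure:
  "(\<exists>\<mu>\<in>prob_measures X d. d_invariant X d \<mu>) \<longleftrightarrow>
    (\<exists>w. (\<forall>x\<in>X. 0 \<le> w x) \<and> sum w X = 1 \<and> invariant_weight w)"
  by (auto simp: prob_measures_eq d_invariant_weight_measure)

lemma weight_measure_eq_iff: "weight_measure X u = weight_measure X v \<longleftrightarrow> (\<forall>x\<in>X. u x = v x)"
  using weight_measure_singleton weight_measure_cong by metis

lemma ex1_invariant_signed_measure:
  "(\<exists>!\<mu>. \<mu> \<in> signed_measures_1 X d \<and> d_invariant X d \<mu>) \<longleftrightarrow>
    (\<exists>w. sum w X = 1 \<and> invariant_weight w) \<and>
    (\<forall>u v. sum u X = 1 \<and> invariant_weight u \<and> sum v X = 1 \<and> invariant_weight v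
      \<longrightarrow> (\<forall>x\<in>X. u x = v x))"
proof -
  have "(\<exists>!\<mu>. \<mu> \<in> signed_measures_1 X d \<and> d_invariant X d \<mu>) \<longleftrightarrow>
    (\<exists>\<mu>\<in>signed_measures_1 X d. d_invariant X d \<mu>) \<and>
    (\<forall>\<mu>\<in>signed_measures_1 X d. \<forall>\<nu>\<in>signed_measures_1 X d.
      d_invariant X d \<mu> \<and> d_invariant X d \<nu> \<longrightarrow> \<mu> = \<nu>)"
    by blast
  then show ?thesis
    unfolding signed_measures_1_eq
    by (simp add: d_invariant_weight_measure weight_measure_eq_iff) blast
qed

text \<open>The defining inequality, applied to an enumeration of \<open>X\<close> without
  repetitions.\<close>

lemma quasihypermetric_weights: "sum w X = 0 \<Longrightarrow> dist_form w w \<le> 0"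
proof -
  assume w: "sum w X = 0"
  obtain h where h: "bij_betw h {1..card X} X"
    using ex_bij_betw_nat_finite_1 [OF finite_space] by blast
  note re = sum.reindex_bij_betw [OF h]
  have "(\<Sum>i=1..card X. \<Sum>j=1..card X. w (h i) * w (h j) * d (h i) (h j)) \<le> 0"
    using quasihypermetric h w re [of w] bij_betwE [OF h] unfolding quasihypermetric_def
    by (elim allE [of _ "card X"] allE [of _ h] allE [of _ "\<lambda>i. w (h i)"]) auto
  then show ?thesis
    using re [of "\<lambda>x. \<Sum>j=1..card X. w x * w (h j) * d x (h j)"]
      re [of "\<lambda>y. w _ * w y * d _ y"] by (simp add: dist_form_def)
qed

lemma strictly_quasihypermetric_weights:
  "strictly_quasihypermetric X d \<longleftrightarrow>
    (\<forall>w. sum w X = 0 \<and> dist_form w w = 0 \<longrightarrow> (\<forall>x\<in>X. w x = 0))"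
proof -
  have "weight_measure X w = (\<lambda>A. 0) \<longleftrightarrow> (\<forall>x\<in>X. w x = 0)" for w
  proof -
    have "weight_measure X (\<lambda>_. 0) = (\<lambda>A. 0)" by (simp add: weight_measure_def fun_eq_iff)
    then show ?thesis using weight_measure_eq_iff [of w "\<lambda>_. 0"] by simp
  qed
  then show ?thesis
    by (auto simp: strictly_quasihypermetric_def quasihypermetric signed_measures_0_eq
        energy_weight_measure)
qed

section \<open>Bilinear calculus of the mutual energy\<close>

lemma dist_form_eq_potential: "dist_form u v = (\<Sum>x\<in>X. u x * weight_potential v x)"
  by (simp add: dist_form_def weight_potential_def sum_distrib_left mult_ac)

lemma dist_form_commute: "dist_form u v = dist_form v u"
  unfolding dist_form_def by (subst sum.swap) (simp add: mult_ac commute)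

lemma weight_potential_add:
  "weight_potential (\<lambda>x. u x + t * v x) x = weight_potential u x + t * weight_potential v x"
  by (simp add: weight_potential_def algebra_simps sum.distrib sum_distrib_left)

lemma dist_form_add_right:
  "dist_form u (\<lambda>x. v x + t * w x) = dist_form u v + t * dist_form u w"
  by (simp add: dist_form_eq_potential weight_potential_add algebra_simps sum.distrib sum_distrib_left)

lemma dist_form_add_left:
  "dist_form (\<lambda>x. v x + t * w x) u = dist_form v u + t * dist_form w u"
  by (metis dist_form_commute dist_form_add_right)

lemma dist_form_add_self:
  "dist_form (\<lambda>x. u x + t * v x) (\<lambda>x. u x + t * v x) =
    dist_form u u + 2 * t * dist_form u v + t\<^sup>2 * dist_form v v"
  by (simp add: dist_form_add_right dist_form_add_left dist_form_commute [of v u]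
      algebra_simps power2_eq_square)

text \<open>Pairing with a constant potential multiplies the constant by the mass of
  \<open>u\<close>. Thus invariant weights are critical points of the energy among weights of equal
  mass.\<close>

lemma dist_form_invariant_right:
  assumes "invariant_weight w" "sum u X = 0"
  shows "dist_form u w = 0"
proof -
  obtain c where "\<forall>x\<in>X. weight_potential w x = c" using assms(1) by (auto simp: invariant_weight_def)
  then have "dist_form u w = sum u X * c" by (simp add: dist_form_eq_potential sum_distrib_right)
  then show ?thesis using assms(2) by simp
qed

section \<open>Invariant weights as maximisers of the energy\<close>

lemma invariant_weight_maximises:
  assumes "invariant_weight w" "sum w X = 1" "sum v X = 1"
  shows "dist_form v v \<le> dist_form w w"
proof -
  let ?u = "\<lambda>x. v x - w x"
  have u: "sum ?u X = 0" using assms by (simp add: sum_subtractf)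
  \<comment> \<open>In this expansion at \<open>w\<close> the linear term vanishes by invariance,
    and the quadratic term is nonpositive because \<open>?u\<close> has mass
    \<open>0\<close>.\<close>
  have "dist_form v v = dist_form w w + 2 * dist_form w ?u + dist_form ?u ?u"
    using dist_form_add_self [of w 1 ?u] by simp
  then show ?thesis
    using dist_form_invariant_right [OF assms(1) u] quasihypermetric_weights [OF u]
    by (simp add: dist_form_commute [of w ?u])
qed

text \<open>First-order condition: a nonzero derivative in some direction of mass \<open>0\<close>
  would allow the energy to grow. Testing with differences of point masses then equates the
  potentials at any two points.\<close>

lemma maximiser_invariant_weight:
  assumes w: "sum w X = 1" and max: "\<And>v. sum v X = 1 \<Longrightarrow> dist_form v v \<le> dist_form w w"
  shows "invariant_weight w"
proof -
  have zero: "dist_form w u = 0" if u: "sum u X = 0" for u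
  proof (rule ccontr)
    assume nz: "dist_form w u \<noteq> 0"
    define p q where "p = dist_form w u" and "q = - dist_form u u"
    have q: "0 \<le> q" using quasihypermetric_weights [OF u] by (simp add: q_def)
    have "2 * t * p \<le> t\<^sup>2 * q" for t
    proof -
      have "sum (\<lambda>x. w x + t * u x) X = 1"
        using w u by (simp add: sum.distrib flip: sum_distrib_left)
      from max [OF this] show ?thesis by (simp add: dist_form_add_self p_def q_def)
    qed
    \<comment> \<open>The best step would be \<open>p / q\<close>; adding \<open>1\<close> keeps the
      denominator positive when \<open>q = 0\<close>.\<close>
    from this [of "p / (q + 1)"] have "p\<^sup>2 / (q + 1) * 2 \<le> p\<^sup>2 / (q + 1) * (q / (q + 1))"
      by (simp add: power2_eq_square mult_ac)
    moreover have "0 < p\<^sup>2 / (q + 1)" using nz q by (simp add: p_def)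
    ultimately have "2 \<le> q / (q + 1)" by (simp only: mult_le_cancel_left_pos)
    with q show False by (simp add: field_simps)
  qed
  have "weight_potential w x = weight_potential w y" if "x \<in> X" "y \<in> X" for x y
  proof -
    \<comment> \<open>The point mass at \<open>x\<close> minus the point mass at
      \<open>y\<close>.\<close>
    let ?u = "\<lambda>z. (if z = x then 1 else 0) - (if z = y then 1 else 0 :: real)"
    have "sum ?u X = 0" using that finite_space by (simp add: sum_subtractf)
    from zero [OF this] have "dist_form ?u w = 0" by (simp add: dist_form_commute)
    moreover have "dist_form ?u w = weight_potential w x - weight_potential w y"
      using that finite_space
      by (simp add: dist_form_eq_potential left_diff_distrib sum_subtractf
          if_distrib [of "\<lambda>t. t * _"] cong: if_cong)
    ultimately show ?thesis by simp
  qed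
  then show ?thesis using space_nonempty unfolding invariant_weight_def by blast
qed

text \<open>Along a weight \<open>u\<close> as in the conclusion the energy is affine with slope \<open>2c\<close>, so it is
  unbounded above.\<close>

lemma no_invariant_weight_imp_null_direction:
  assumes "\<nexists>w. sum w X = 1 \<and> invariant_weight w"
  obtains u c where "sum u X = 0" "\<And>x. x \<in> X \<Longrightarrow> weight_potential u x = c" "c \<noteq> 0"
proof -
  \<comment> \<open>Unknowns \<open>(w, c)\<close>, with \<open>None\<close> indexing both \<open>c\<close> and the mass equation.\<close>
  define A :: "'a option \<Rightarrow> 'a option \<Rightarrow> real" where
    "A = (\<lambda>j i. case (j, i) of (Some x, Some y) \<Rightarrow> d x y | (None, None) \<Rightarrow> 0 | _ \<Rightarrow> 1)"
  define b :: "'a option \<Rightarrow> real" where "b = (\<lambda>j. if j = None then 1 else 0)"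
  define I where "I = insert None (Some ` X)"
  have I: "finite I" using finite_space by (simp add: I_def)
  have sum_I: "sum f I = f None + (\<Sum>x\<in>X. f (Some x))" for f :: "'a option \<Rightarrow> real"
    using finite_space by (simp add: I_def sum.reindex)
  have ball_I: "(\<forall>j\<in>I. P j) \<longleftrightarrow> P None \<and> (\<forall>x\<in>X. P (Some x))" for P
    by (auto simp: I_def)
  have "\<not> (\<exists>w. \<forall>j\<in>I. (\<Sum>i\<in>I. A j i * w i) = b j)"
  proof
    assume "\<exists>w. \<forall>j\<in>I. (\<Sum>i\<in>I. A j i * w i) = b j"
    then obtain w where w: "\<forall>j\<in>I. (\<Sum>i\<in>I. A j i * w i) = b j" by blast
    then have "sum (\<lambda>x. w (Some x)) X = 1"
      "\<forall>x\<in>X. w None + (\<Sum>y\<in>X. d x y * w (Some y)) = 0"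
      by (auto simp: sum_I ball_I A_def b_def)
    \<comment> \<open>The auxiliary unknown is minus the constant potential.\<close>
    then have "sum (\<lambda>x. w (Some x)) X = 1 \<and> (\<forall>x\<in>X. weight_potential (\<lambda>x. w (Some x)) x = - w None)"
      by (auto simp: weight_potential_def mult.commute add_eq_0_iff)
    then show False using assms unfolding invariant_weight_def by blast
  qed
  then obtain u where "\<forall>i\<in>I. (\<Sum>j\<in>I. u j * A j i) = 0" "(\<Sum>j\<in>I. u j * b j) \<noteq> 0"
    using fredholm_alternative [OF I I, of A b] by blast
  \<comment> \<open>The certificate solves the same equations with mass \<open>0\<close>, as
    \<open>A\<close> is symmetric; its pairing with \<open>b\<close> is \<open>u None\<close>, which
    is therefore nonzero.\<close>
  then have "sum (\<lambda>x. u (Some x)) X = 0"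
    "\<forall>x\<in>X. u None + (\<Sum>y\<in>X. u (Some y) * d y x) = 0" "u None \<noteq> 0"
    by (auto simp: sum_I ball_I A_def b_def)
  then show thesis
    by (intro that [of "\<lambda>x. u (Some x)" "- u None"])
      (auto simp: weight_potential_def commute add_eq_0_iff)
qed

text \<open>By contradiction: a point mass is the starting point from which a null direction is
  followed.\<close>

lemma bounded_energy_imp_invariant_weight:
  assumes bound: "\<And>w. sum w X = 1 \<Longrightarrow> dist_form w w \<le> C"
  shows "\<exists>w. sum w X = 1 \<and> invariant_weight w"
proof (rule ccontr)
  assume "\<nexists>w. sum w X = 1 \<and> invariant_weight w"
  then obtain u c where u: "sum u X = 0" "\<And>x. x \<in> X \<Longrightarrow> weight_potential u x = c" "c \<noteq> 0"
    by (rule no_invariant_weight_imp_null_direction) blast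
  obtain a where a: "a \<in> X" using space_nonempty by blast
  define e where "e = (\<lambda>x. if x = a then 1 else 0 :: real)"
  have e: "sum e X = 1" using a finite_space by (simp add: e_def)
  have form: "dist_form v u = sum v X * c" for v
    by (simp add: dist_form_eq_potential u(2) sum_distrib_right)
  have "dist_form e e + 2 * t * c \<le> C" for t
  proof -
    have "sum (\<lambda>x. e x + t * u x) X = 1"
      using e u(1) by (simp add: sum.distrib flip: sum_distrib_left)
    from bound [OF this] show ?thesis by (simp add: dist_form_add_self form e u(1))
  qed
  \<comment> \<open>Replacing \<open>t\<close> by \<open>t / (2 * c)\<close> makes the slope
    \<open>1\<close>, whatever the sign of \<open>c\<close>.\<close>
  then have "dist_form e e + t \<le> C" for t
    using u(3) by (elim meta_allE [of _ "t / (2 * c)"]) simp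
  from this [of "C - dist_form e e + 1"] show False by simp
qed

text \<open>A finite supremum is a bound on the energy, and an invariant weight attains the
  supremum.\<close>

lemma M_sup_finite_iff: "M_sup X d < \<infinity> \<longleftrightarrow> (\<exists>w. sum w X = 1 \<and> invariant_weight w)"
proof
  assume "M_sup X d < \<infinity>"
  then have "ereal (dist_form w w) \<le> ereal (real_of_ereal (M_sup X d))" if "sum w X = 1" for w
  proof -
    have "ereal (dist_form w w) \<le> M_sup X d" unfolding M_sup_eq using that by (intro SUP_upper) auto
    with \<open>M_sup X d < \<infinity>\<close> show ?thesis by (cases "M_sup X d") auto
  qed
  then show "\<exists>w. sum w X = 1 \<and> invariant_weight w"
    by (intro bounded_energy_imp_invariant_weight [of "real_of_ereal (M_sup X d)"]) simp
next
  assume "\<exists>w. sum w X = 1 \<and> invariant_weight w"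
  then obtain w where w: "sum w X = 1" "invariant_weight w" by blast
  have "M_sup X d \<le> ereal (dist_form w w)"
    unfolding M_sup_eq by (intro SUP_least) (use invariant_weight_maximises w in auto)
  then show "M_sup X d < \<infinity>" by (auto simp: less_le)
qed

text \<open>The energy is continuous on the compact simplex of probability weights.\<close>

lemma ex_max_prob_weight:
  obtains w :: "'a \<Rightarrow> real" where "\<forall>x\<in>X. 0 \<le> w x" "sum w X = 1"
    "\<And>v. \<forall>x\<in>X. 0 \<le> v x \<Longrightarrow> sum v X = 1 \<Longrightarrow> dist_form v v \<le> dist_form w w"
proof -
  \<comment> \<open>A product of compact sets, hence compact by Tychonoff. Weights are functions on
    the whole type, so their values off \<open>X\<close> are pinned to \<open>0\<close>.\<close>
  define B where "B = PiE UNIV (\<lambda>x. if x \<in> X then {0..1::real} else {0})"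
  define K where "K = B \<inter> {w. sum w X = 1}"
  have cont: "continuous_on S (\<lambda>w::'a \<Rightarrow> real. w x)" for S x
    by (rule continuous_on_subset [OF continuous_on_product_coordinates]) simp
  have "compactin (product_topology (\<lambda>_. euclidean) UNIV) B"
    unfolding B_def compactin_PiE by (auto simp: compactin_euclidean_iff)
  then have "compact B" by (simp add: euclidean_product_topology compactin_euclidean_iff)
  moreover have "closed {w :: 'a \<Rightarrow> real. sum w X = 1}"
    by (intro closed_Collect_eq continuous_intros cont)
  ultimately have "compact K" unfolding K_def by (rule compact_Int_closed)
  obtain a where a: "a \<in> X" using space_nonempty by blast
  then have "(\<lambda>x. if x = a then 1 else 0) \<in> K"
    using finite_space by (auto simp: K_def B_def)
  then have "K \<noteq> {}" by blast
  moreover have "continuous_on K (\<lambda>w. dist_form w w)"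
    unfolding dist_form_def by (intro continuous_intros cont)
  ultimately obtain w where w: "w \<in> K" "\<forall>v\<in>K. dist_form v v \<le> dist_form w w"
    using continuous_attains_sup [OF \<open>compact K\<close>] by blast
  show thesis
  proof (rule that [of w])
    show "\<forall>x\<in>X. 0 \<le> w x" using w(1) by (force simp: K_def B_def PiE_iff split: if_splits)
    show "sum w X = 1" using w(1) by (simp add: K_def)
    fix v :: "'a \<Rightarrow> real" assume v: "\<forall>x\<in>X. 0 \<le> v x" "sum v X = 1"
    \<comment> \<open>A competitor is moved into \<open>K\<close> by clearing its values off
      \<open>X\<close>, which leaves its energy unchanged.\<close>
    define v' where "v' = (\<lambda>x. if x \<in> X then v x else 0)"
    have "v x \<le> 1" if "x \<in> X" for x
      using member_le_sum [OF that, of v] v finite_space by auto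
    then have "v' \<in> K" using v by (auto simp: K_def B_def v'_def)
    moreover have "dist_form v' v' = dist_form v v" by (simp add: dist_form_def v'_def)
    ultimately show "dist_form v v \<le> dist_form w w" using w(2) by metis
  qed
qed

text \<open>The supremum over probability weights is attained by compactness, hence finite. If it
  equals \<open>M_sup X d\<close>, its maximiser is one among all weights of mass \<open>1\<close>,
  hence invariant; conversely a nonnegative invariant weight attains both suprema.\<close>

lemma M_plus_sup_eq_M_sup_iff:
  "M_plus_sup X d = M_sup X d \<longleftrightarrow>
    (\<exists>w. (\<forall>x\<in>X. 0 \<le> w x) \<and> sum w X = 1 \<and> invariant_weight w)"
proof
  assume eq: "M_plus_sup X d = M_sup X d"
  obtain w where w: "\<forall>x\<in>X. 0 \<le> w x" "sum w X = 1"
    and max: "\<And>v. \<forall>x\<in>X. 0 \<le> v x \<Longrightarrow> sum v X = 1 \<Longrightarrow> dist_form v v \<le> dist_form w w"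
    by (rule ex_max_prob_weight) blast
  have "M_plus_sup X d \<le> ereal (dist_form w w)"
    unfolding M_plus_sup_eq by (intro SUP_least) (use max in auto)
  then have le: "M_sup X d \<le> ereal (dist_form w w)" by (simp add: eq)
  have "dist_form v v \<le> dist_form w w" if "sum v X = 1" for v
  proof -
    have "ereal (dist_form v v) \<le> M_sup X d" unfolding M_sup_eq using that by (intro SUP_upper) auto
    with le show ?thesis using ereal_less_eq(3) order_trans by metis
  qed
  then have "invariant_weight w" using maximiser_invariant_weight w(2) by blast
  with w show "\<exists>w. (\<forall>x\<in>X. 0 \<le> w x) \<and> sum w X = 1 \<and> invariant_weight w" by blast
next
  assume "\<exists>w. (\<forall>x\<in>X. 0 \<le> w x) \<and> sum w X = 1 \<and> invariant_weight w"
  then obtain w where w: "\<forall>x\<in>X. 0 \<le> w x" "sum w X = 1" "invariant_weight w" by blast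
  show "M_plus_sup X d = M_sup X d"
  proof (rule antisym)
    show "M_plus_sup X d \<le> M_sup X d"
      unfolding M_plus_sup_eq M_sup_eq by (rule SUP_subset_mono) auto
    have "M_sup X d \<le> ereal (dist_form w w)"
      unfolding M_sup_eq by (intro SUP_least) (use invariant_weight_maximises w in auto)
    also have "\<dots> \<le> M_plus_sup X d"
      unfolding M_plus_sup_eq using w by (intro SUP_upper) auto
    finally show "M_sup X d \<le> M_plus_sup X d" .
  qed
qed

section \<open>S-embeddings\<close>

text \<open>After fixing a base point, polarisation dictates the inner products of the vectors
  sought; quasihypermetricity makes their matrix positive semidefinite, so it is a Gram
  matrix.\<close>

lemma ex_S_embedding: "\<exists>m \<phi>. S_embedding X d m \<phi>"
proof -
  obtain a where a: "a \<in> X" using space_nonempty by blast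
  \<comment> \<open>What the inner product of \<open>\<phi> x - \<phi> a\<close> and
    \<open>\<phi> y - \<phi> a\<close> must be for an S-embedding \<open>\<phi>\<close>.\<close>
  define G where "G = (\<lambda>x y. (d x a + d y a - d x y) / 2)"
  have "0 \<le> (\<Sum>x\<in>X. \<Sum>y\<in>X. c x * c y * G x y)" for c
  proof -
    define s where "s = sum c X"
    define e where "e = (\<lambda>x. if x = a then 1 else 0 :: real)"
    \<comment> \<open>Changing \<open>c\<close> at \<open>a\<close> alone brings its mass to
      \<open>0\<close>; row and column \<open>a\<close> of \<open>G\<close> are zero, so the form
      does not notice.\<close>
    define w where "w = (\<lambda>x. c x + (- s) * e x)"
    have e: "sum e X = 1" using a finite_space by (simp add: e_def)
    have "sum w X = s + (- s) * sum e X"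
      by (simp only: w_def sum.distrib s_def flip: sum_distrib_left)
    then have "sum w X = 0" by (simp add: e)
    then have le: "dist_form w w \<le> 0" by (rule quasihypermetric_weights)
    have pot_e: "weight_potential e x = d x a" for x
      using a finite_space
      by (simp add: weight_potential_def e_def if_distrib [of "\<lambda>t. t * _"] cong: if_cong)
    have ee: "dist_form e e = 0"
      using a finite_space
      by (simp add: dist_form_eq_potential pot_e) (simp add: e_def if_distrib [of "\<lambda>t. t * _"] cong: if_cong)
    have ce: "dist_form c e = (\<Sum>x\<in>X. c x * d x a)"
      by (simp add: dist_form_eq_potential pot_e)
    have 1: "(\<Sum>x\<in>X. \<Sum>y\<in>X. c x * c y * d x a) = s * dist_form c e"
      unfolding ce s_def sum_product by (subst sum.swap) (simp add: mult_ac)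
    have 2: "(\<Sum>x\<in>X. \<Sum>y\<in>X. c x * c y * d y a) = s * dist_form c e"
      unfolding ce s_def sum_product by (simp add: mult_ac)
    have "(\<Sum>x\<in>X. \<Sum>y\<in>X. c x * c y * G x y) =
      (\<Sum>x\<in>X. \<Sum>y\<in>X. (c x * c y * d x a + c x * c y * d y a - c x * c y * d x y) / 2)"
      by (simp add: G_def algebra_simps)
    also have "\<dots> = (s * dist_form c e + s * dist_form c e - dist_form c c) / 2"
      by (simp add: sum.distrib sum_subtractf 1 2 dist_form_def [of c c] flip: sum_divide_distrib)
    also have "\<dots> = - dist_form w w / 2"
      by (simp only: w_def dist_form_add_self) (simp add: ee)
    finally show ?thesis using le by simp
  qed
  then obtain m :: nat and f where f: "\<forall>x\<in>X. \<forall>y\<in>X. G x y = (\<Sum>i<m. f x i * f y i)"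
    using positive_semidefinite_imp_gram [OF finite_space, of G] by (auto simp: G_def commute)
  \<comment> \<open>Cutting off at \<open>m\<close> gives finite support and puts the vectors in
    \<open>euclid m\<close>.\<close>
  define \<phi> where "\<phi> = (\<lambda>x. Poly_Mapping.Abs_poly_mapping (\<lambda>i. f x i when i < m))"
  have lookup: "Poly_Mapping.lookup (\<phi> x) i = (f x i when i < m)" for x i
  proof -
    have "finite {i. (f x i when i < m) \<noteq> 0}"
      by (rule finite_subset [of _ "{..<m}"]) (auto simp: when_def)
    then show ?thesis by (simp add: \<phi>_def lookup_Abs_poly_mapping)
  qed
  have inner: "euclid_inner m (\<phi> x) (\<phi> y) = G x y" if "x \<in> X" "y \<in> X" for x y
    using f that by (simp add: euclid_inner_def lookup)
  have "S_embedding X d m \<phi>"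
    unfolding S_embedding_def euclid_norm_sq euclid_inner_diff_self
    by (auto simp: inner euclid_def lookup) (simp add: G_def field_simps)
  then show ?thesis by blast
qed

text \<open>Lets a statement about every minimal embedding imply the one about some minimal
  embedding.\<close>

lemma ex_minimal_S_embedding: "\<exists>m \<phi>. minimal_S_embedding X d m \<phi>"
proof -
  let ?P = "\<lambda>m. \<exists>\<phi>. S_embedding X d m \<phi>"
  have "?P (LEAST m. ?P m)" using ex_S_embedding by (rule LeastI_ex)
  then show ?thesis unfolding minimal_S_embedding_def by (metis (mono_tags, lifting) Least_le)
qed

section \<open>Barycentres under a fixed S-embedding\<close>

context
  fixes m \<phi>
  assumes emb: "S_embedding X d m \<phi>"
begin

lemma S_embedding_image: "\<phi> ` X \<subseteq> euclid m"
  using emb by (simp add: S_embedding_def)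

lemma S_embedding_dist:
  assumes "x \<in> X" "y \<in> X"
  shows "d x y = euclid_inner m (\<phi> x) (\<phi> x) + euclid_inner m (\<phi> y) (\<phi> y)
    - 2 * euclid_inner m (\<phi> x) (\<phi> y)"
  using emb assms unfolding S_embedding_def by (metis euclid_norm_sq euclid_inner_diff_self)

text \<open>Lets sums over the image be reindexed by \<open>X\<close>.\<close>

lemma S_embedding_inj: "inj_on \<phi> X"
proof (rule inj_onI)
  fix x y assume "x \<in> X" "y \<in> X" "\<phi> x = \<phi> y"
  then show "x = y" using S_embedding_dist [of x y] zero [of x y] by simp
qed

text \<open>The law of cosines, integrated against \<open>w\<close> in one variable.\<close>

lemma weight_potential_S_embedding:
  assumes "x \<in> X"
  shows "weight_potential w x = sum w X * euclid_inner m (\<phi> x) (\<phi> x)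
    + (\<Sum>y\<in>X. w y * euclid_inner m (\<phi> y) (\<phi> y))
    - 2 * euclid_inner m (\<phi> x) (\<Sum>y\<in>X. w y *\<^sub>R \<phi> y)"
proof -
  have "weight_potential w x = (\<Sum>y\<in>X. w y * euclid_inner m (\<phi> x) (\<phi> x)
      + w y * euclid_inner m (\<phi> y) (\<phi> y) - 2 * (w y * euclid_inner m (\<phi> x) (\<phi> y)))"
    unfolding weight_potential_def
    by (intro sum.cong refl) (simp add: S_embedding_dist assms algebra_simps)
  then show ?thesis
    by (simp add: sum.distrib sum_subtractf euclid_inner_sum_right sum_distrib_left sum_distrib_right)
qed

text \<open>The potential formula integrated once more. At mass \<open>0\<close> the first term
  drops out.\<close>

lemma dist_form_S_embedding:
  "dist_form w w = 2 * sum w X * (\<Sum>y\<in>X. w y * euclid_inner m (\<phi> y) (\<phi> y))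
    - 2 * euclid_inner m (\<Sum>y\<in>X. w y *\<^sub>R \<phi> y) (\<Sum>y\<in>X. w y *\<^sub>R \<phi> y)"
proof -
  let ?z = "\<Sum>y\<in>X. w y *\<^sub>R \<phi> y" and ?q = "\<Sum>y\<in>X. w y * euclid_inner m (\<phi> y) (\<phi> y)"
  have "dist_form w w = (\<Sum>x\<in>X. sum w X * (w x * euclid_inner m (\<phi> x) (\<phi> x)) + w x * ?q
      - 2 * (w x * euclid_inner m ?z (\<phi> x)))"
    unfolding dist_form_eq_potential
    by (intro sum.cong refl)
      (simp add: weight_potential_S_embedding algebra_simps euclid_inner_commute [of m ?z])
  also have "\<dots> = sum w X * ?q + sum w X * ?q - 2 * euclid_inner m ?z ?z"
    by (simp add: sum.distrib sum_subtractf euclid_inner_sum_right [of m ?z]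
        flip: sum_distrib_left sum_distrib_right)
  finally show ?thesis by simp
qed

lemma invariant_weight_iff_sphere:
  assumes "sum w X = 1"
  shows "invariant_weight w \<longleftrightarrow>
    (\<exists>r\<ge>0. \<phi> ` X \<subseteq> euclid_sphere m (\<Sum>y\<in>X. w y *\<^sub>R \<phi> y) r)"
proof -
  define z where "z = (\<Sum>y\<in>X. w y *\<^sub>R \<phi> y)"
  \<comment> \<open>As \<open>w\<close> has mass \<open>1\<close>, this is its second moment about
    \<open>z\<close>, the constant left over on completing the square in the potential.\<close>
  define k where "k = (\<Sum>y\<in>X. w y * euclid_inner m (\<phi> y) (\<phi> y)) - euclid_inner m z z"
  have pot: "weight_potential w x = (euclid_norm m (\<phi> x - z))\<^sup>2 + k" if "x \<in> X" for x
    using weight_potential_S_embedding [OF that, of w] assms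
    by (simp add: euclid_norm_sq euclid_inner_diff_self z_def k_def)
  have sphere: "\<phi> ` X \<subseteq> euclid_sphere m z r \<longleftrightarrow> (\<forall>x\<in>X. euclid_norm m (\<phi> x - z) = r)" for r
    using S_embedding_image by (auto simp: euclid_sphere_def)
  obtain a where a: "a \<in> X" using space_nonempty by blast
  show ?thesis unfolding z_def [symmetric] sphere
  proof
    assume "invariant_weight w"
    then obtain c where c: "\<And>x. x \<in> X \<Longrightarrow> (euclid_norm m (\<phi> x - z))\<^sup>2 + k = c"
      using pot by (auto simp: invariant_weight_def)
    have "euclid_norm m (\<phi> x - z) = euclid_norm m (\<phi> a - z)" if "x \<in> X" for x
    proof (rule power2_eq_imp_eq)
      show "(euclid_norm m (\<phi> x - z))\<^sup>2 = (euclid_norm m (\<phi> a - z))\<^sup>2"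
        using c [OF that] c [OF a] by linarith
    qed (rule euclid_norm_nonneg)+
    then show "\<exists>r\<ge>0. \<forall>x\<in>X. euclid_norm m (\<phi> x - z) = r"
      by (intro exI [of _ "euclid_norm m (\<phi> a - z)"] conjI ballI euclid_norm_nonneg)
  next
    assume "\<exists>r\<ge>0. \<forall>x\<in>X. euclid_norm m (\<phi> x - z) = r"
    then show "invariant_weight w" by (auto simp: invariant_weight_def pot)
  qed
qed

text \<open>The centre of the given sphere may lie outside the affine hull of the image; bounding the
  energy by \<open>2r\<^sup>2\<close> avoids projecting it there.\<close>

lemma lies_on_sphere_iff:
  "lies_on_sphere m (\<phi> ` X) \<longleftrightarrow> (\<exists>w. sum w X = 1 \<and> invariant_weight w)"
proof
  assume "\<exists>w. sum w X = 1 \<and> invariant_weight w"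
  then show "lies_on_sphere m (\<phi> ` X)"
    unfolding lies_on_sphere_def
    using invariant_weight_iff_sphere euclid_sum_scaleR [OF S_embedding_image] by blast
next
  assume "lies_on_sphere m (\<phi> ` X)"
  then obtain z r where zr: "z \<in> euclid m" "\<phi> ` X \<subseteq> euclid_sphere m z r"
    by (auto simp: lies_on_sphere_def)
  have r: "euclid_inner m (\<phi> x) (\<phi> x) = r\<^sup>2 - euclid_inner m z z + 2 * euclid_inner m z (\<phi> x)"
    if "x \<in> X" for x
  proof -
    have "euclid_norm m (\<phi> x - z) = r" using zr(2) that by (auto simp: euclid_sphere_def)
    then have "euclid_inner m (\<phi> x - z) (\<phi> x - z) = r\<^sup>2" by (simp flip: euclid_norm_sq)
    then show ?thesis by (simp add: euclid_inner_diff_self euclid_inner_commute [of m z "\<phi> x"])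
  qed
  have "dist_form w w \<le> 2 * r\<^sup>2" if w: "sum w X = 1" for w
  proof -
    let ?s = "\<Sum>y\<in>X. w y *\<^sub>R \<phi> y"
    have "(\<Sum>y\<in>X. w y * euclid_inner m (\<phi> y) (\<phi> y)) =
        (\<Sum>y\<in>X. w y * (r\<^sup>2 - euclid_inner m z z) + 2 * (w y * euclid_inner m z (\<phi> y)))"
      by (intro sum.cong refl) (simp add: r algebra_simps)
    also have "\<dots> = r\<^sup>2 - euclid_inner m z z + 2 * euclid_inner m z ?s"
      by (simp add: sum.distrib w euclid_inner_sum_right flip: sum_distrib_left sum_distrib_right)
    \<comment> \<open>Completing the square: the deficit from \<open>2 * r\<^sup>2\<close> is twice
      the squared distance from the barycentre to the centre.\<close>
    finally have "dist_form w w = 2 * r\<^sup>2 - 2 * euclid_inner m (?s - z) (?s - z)"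
      by (simp add: dist_form_S_embedding w euclid_inner_diff_self euclid_inner_commute [of m z ?s])
    then show ?thesis using euclid_inner_nonneg [of m "?s - z"] by simp
  qed
  then show "\<exists>w. sum w X = 1 \<and> invariant_weight w"
    by (rule bounded_energy_imp_invariant_weight)
qed

text \<open>By injectivity, convex coefficients on the image correspond to probability weights on
  \<open>X\<close>.\<close>

lemma convex_hull_S_embedding:
  "convex hull (\<phi> ` X) = {\<Sum>y\<in>X. w y *\<^sub>R \<phi> y |w. (\<forall>x\<in>X. 0 \<le> w x) \<and> sum w X = 1}"
proof -
  let ?W = "{\<Sum>y\<in>X. w y *\<^sub>R \<phi> y |w. (\<forall>x\<in>X. 0 \<le> w x) \<and> sum w X = 1}"
  note hull = convex_hull_finite [OF finite_imageI [OF finite_space], of \<phi>]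
  show ?thesis
  proof (intro subset_antisym subsetI)
    fix z assume "z \<in> convex hull (\<phi> ` X)"
    then obtain u where "\<forall>p\<in>\<phi> ` X. 0 \<le> u p" "sum u (\<phi> ` X) = 1" "(\<Sum>p\<in>\<phi> ` X. u p *\<^sub>R p) = z"
      unfolding hull by blast
    then show "z \<in> ?W"
      by (intro CollectI exI [of _ "u \<circ> \<phi>"]) (auto simp: sum.reindex [OF S_embedding_inj])
  next
    fix z assume "z \<in> ?W"
    then obtain w where "\<forall>x\<in>X. 0 \<le> w x" "sum w X = 1" "z = (\<Sum>y\<in>X. w y *\<^sub>R \<phi> y)" by blast
    then show "z \<in> convex hull (\<phi> ` X)"
      unfolding hull using S_embedding_inj
      by (intro CollectI exI [of _ "w \<circ> the_inv_into X \<phi>"])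
        (auto simp: sum.reindex [OF S_embedding_inj] the_inv_into_f_f)
  qed
qed

text \<open>A centre in the convex hull is the barycentre of a probability weight, so the criterion
  for spheres centred at barycentres applies to it directly.\<close>

lemma lies_on_sphere_centred_in_hull_iff:
  "lies_on_sphere_centred_in_hull m (\<phi> ` X) \<longleftrightarrow>
    (\<exists>w. (\<forall>x\<in>X. 0 \<le> w x) \<and> sum w X = 1 \<and> invariant_weight w)"
proof
  assume "lies_on_sphere_centred_in_hull m (\<phi> ` X)"
  then obtain z r where zr: "r \<ge> 0" "\<phi> ` X \<subseteq> euclid_sphere m z r" "z \<in> convex hull (\<phi> ` X)"
    by (auto simp: lies_on_sphere_centred_in_hull_def)
  then obtain w where "\<forall>x\<in>X. 0 \<le> w x" "sum w X = 1" "z = (\<Sum>y\<in>X. w y *\<^sub>R \<phi> y)"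
    by (auto simp: convex_hull_S_embedding)
  then show "\<exists>w. (\<forall>x\<in>X. 0 \<le> w x) \<and> sum w X = 1 \<and> invariant_weight w"
    using invariant_weight_iff_sphere zr by blast
next
  assume "\<exists>w. (\<forall>x\<in>X. 0 \<le> w x) \<and> sum w X = 1 \<and> invariant_weight w"
  then obtain w where w: "\<forall>x\<in>X. 0 \<le> w x" "sum w X = 1" "invariant_weight w" by blast
  then have "(\<Sum>y\<in>X. w y *\<^sub>R \<phi> y) \<in> convex hull (\<phi> ` X)"
    by (auto simp: convex_hull_S_embedding)
  then show "lies_on_sphere_centred_in_hull m (\<phi> ` X)"
    unfolding lies_on_sphere_centred_in_hull_def
    using invariant_weight_iff_sphere w euclid_sum_scaleR [OF S_embedding_image] by blast
qed

lemma dist_form_eq_0_iff: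
  assumes "sum u X = 0"
  shows "dist_form u u = 0 \<longleftrightarrow> (\<Sum>y\<in>X. u y *\<^sub>R \<phi> y) = 0"
proof -
  have "dist_form u u = - 2 * euclid_inner m (\<Sum>y\<in>X. u y *\<^sub>R \<phi> y) (\<Sum>y\<in>X. u y *\<^sub>R \<phi> y)"
    using dist_form_S_embedding [of u] assms by simp
  moreover have "euclid_inner m 0 0 = 0" by (simp add: euclid_inner_def)
  ultimately show ?thesis
    using euclid_inner_self_eq_0 [OF euclid_sum_scaleR [OF S_embedding_image]] by auto
qed

lemma affine_dependent_S_embedding_iff:
  "affine_dependent (\<phi> ` X) \<longleftrightarrow>
    (\<exists>u. sum u X = 0 \<and> (\<exists>x\<in>X. u x \<noteq> 0) \<and> (\<Sum>y\<in>X. u y *\<^sub>R \<phi> y) = 0)"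
  (is "?L \<longleftrightarrow> ?R")
proof
  assume ?L
  then obtain U where "sum U (\<phi> ` X) = 0" "\<exists>v\<in>\<phi> ` X. U v \<noteq> 0" "(\<Sum>v\<in>\<phi> ` X. U v *\<^sub>R v) = 0"
    using affine_dependent_explicit_finite [OF finite_imageI [OF finite_space]] by blast
  then show ?R
    by (intro exI [of _ "U \<circ> \<phi>"]) (auto simp: sum.reindex [OF S_embedding_inj])
next
  assume ?R
  then obtain u where "sum u X = 0" "\<exists>x\<in>X. u x \<noteq> 0" "(\<Sum>y\<in>X. u y *\<^sub>R \<phi> y) = 0" by blast
  then show ?L
    unfolding affine_dependent_explicit_finite [OF finite_imageI [OF finite_space]]
    using S_embedding_inj
    by (intro exI [of _ "u \<circ> the_inv_into X \<phi>"])
      (auto simp: sum.reindex [OF S_embedding_inj] the_inv_into_f_f)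
qed

text \<open>An affine dependence of the image is a nonzero weight of mass \<open>0\<close> with
  vanishing vector sum, that is, with zero energy.\<close>

lemma affine_independent_S_embedding_iff:
  "\<not> affine_dependent (\<phi> ` X) \<longleftrightarrow> strictly_quasihypermetric X d"
  unfolding affine_dependent_S_embedding_iff strictly_quasihypermetric_weights
  using dist_form_eq_0_iff by blast

text \<open>At mass \<open>0\<close> and with vanishing vector sum, the terms of the potential that
  depend on the point disappear.\<close>

lemma null_weight_invariant:
  assumes "sum u X = 0" "dist_form u u = 0"
  shows "invariant_weight u"
proof -
  have "(\<Sum>y\<in>X. u y *\<^sub>R \<phi> y) = 0" using assms dist_form_eq_0_iff by blast
  then show ?thesis
    by (simp add: invariant_weight_def weight_potential_S_embedding assms(1) euclid_inner_def)
qed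

end

section \<open>Strictness and uniqueness of the invariant measure\<close>

lemma invariant_weight_add:
  assumes "invariant_weight u" "invariant_weight v"
  shows "invariant_weight (\<lambda>x. u x + t * v x)"
proof -
  obtain b c where "\<forall>x\<in>X. weight_potential u x = b" "\<forall>x\<in>X. weight_potential v x = c"
    using assms by (auto simp: invariant_weight_def)
  then have "\<forall>x\<in>X. weight_potential (\<lambda>x. u x + t * v x) x = b + t * c"
    by (simp add: weight_potential_add)
  then show ?thesis unfolding invariant_weight_def by blast
qed

text \<open>Under strictness a null direction, having mass and energy \<open>0\<close>, would be
  zero and so have zero potential; and the difference of two invariant weights of mass
  \<open>1\<close> has energy \<open>0\<close>. Conversely, adding a weight of mass and energy
  \<open>0\<close> to an invariant weight gives another invariant weight.\<close>

lemma strictly_quasihypermetric_iff_ex1_invariant: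
  "strictly_quasihypermetric X d \<longleftrightarrow> (\<exists>!\<mu>. \<mu> \<in> signed_measures_1 X d \<and> d_invariant X d \<mu>)"
  unfolding ex1_invariant_signed_measure strictly_quasihypermetric_weights
proof (intro iffI conjI allI impI)
  assume strict: "\<forall>w. sum w X = 0 \<and> dist_form w w = 0 \<longrightarrow> (\<forall>x\<in>X. w x = 0)"
  show "\<exists>w. sum w X = 1 \<and> invariant_weight w"
  proof (rule ccontr)
    assume "\<nexists>w. sum w X = 1 \<and> invariant_weight w"
    then obtain u c where u: "sum u X = 0" "\<And>x. x \<in> X \<Longrightarrow> weight_potential u x = c" "c \<noteq> 0"
      by (rule no_invariant_weight_imp_null_direction) blast
    have "dist_form u u = 0"
      using u by (intro dist_form_invariant_right) (auto simp: invariant_weight_def)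
    then have "\<forall>x\<in>X. u x = 0" using strict u(1) by blast
    then have "weight_potential u x = 0" for x by (simp add: weight_potential_def)
    then show False using u(2,3) space_nonempty by auto
  qed
  fix u v
  assume uv: "sum u X = 1 \<and> invariant_weight u \<and> sum v X = 1 \<and> invariant_weight v"
  let ?w = "\<lambda>x. u x + (- 1) * v x"
  have "sum ?w X = 0" using uv by (simp add: sum_subtractf)
  moreover have "dist_form ?w ?w = 0"
    using uv invariant_weight_add calculation by (intro dist_form_invariant_right) blast+
  ultimately have "\<forall>x\<in>X. ?w x = 0" using strict by blast
  then show "\<forall>x\<in>X. u x = v x" by simp
next
  fix u
  assume "(\<exists>w. sum w X = 1 \<and> invariant_weight w) \<and>
    (\<forall>u v. sum u X = 1 \<and> invariant_weight u \<and> sum v X = 1 \<and> invariant_weight v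
      \<longrightarrow> (\<forall>x\<in>X. u x = v x))"
    and u: "sum u X = 0 \<and> dist_form u u = 0"
  then obtain w where w: "sum w X = 1" "invariant_weight w"
    and unique: "\<And>v. sum v X = 1 \<Longrightarrow> invariant_weight v \<Longrightarrow> \<forall>x\<in>X. v x = w x"
    by blast
  obtain m \<phi> where "S_embedding X d m \<phi>" using ex_S_embedding by blast
  then have "invariant_weight (\<lambda>x. w x + 1 * u x)"
    using invariant_weight_add null_weight_invariant u w(2) by blast
  moreover have "sum (\<lambda>x. w x + 1 * u x) X = 1"
    using u w by (simp add: sum.distrib)
  ultimately show "\<forall>x\<in>X. u x = 0" using unique by fastforce
qed

end

theorem theorem3p4:
  fixes X :: "'a set" and d :: "'a \<Rightarrow> 'a \<Rightarrow> real"
  assumes "Metric_space X d" and "finite X" and "X \<noteq> {}"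
    and "quasihypermetric X d"
  shows
    "(((M_sup X d < \<infinity>) \<longleftrightarrow> (\<exists>\<mu>\<in>signed_measures_1 X d. d_invariant X d \<mu>)) \<and>
     ((\<exists>\<mu>\<in>signed_measures_1 X d. d_invariant X d \<mu>) \<longleftrightarrow>
        (\<exists>m \<phi>. S_embedding X d m \<phi> \<and> lies_on_sphere m (\<phi> ` X))) \<and>
     ((\<exists>m \<phi>. S_embedding X d m \<phi> \<and> lies_on_sphere m (\<phi> ` X)) \<longleftrightarrow>
        (\<forall>m \<phi>. S_embedding X d m \<phi> \<longrightarrow> lies_on_sphere m (\<phi> ` X)))) \<and>
     (((M_plus_sup X d = M_sup X d) \<longleftrightarrow> (\<exists>\<mu>\<in>prob_measures X d. d_invariant X d \<mu>)) \<and>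
     ((\<exists>\<mu>\<in>prob_measures X d. d_invariant X d \<mu>) \<longleftrightarrow>
        (\<exists>m \<phi>. minimal_S_embedding X d m \<phi> \<and> lies_on_sphere_centred_in_hull m (\<phi> ` X))) \<and>
     ((\<exists>m \<phi>. minimal_S_embedding X d m \<phi> \<and> lies_on_sphere_centred_in_hull m (\<phi> ` X)) \<longleftrightarrow>
        (\<forall>m \<phi>. minimal_S_embedding X d m \<phi> \<longrightarrow> lies_on_sphere_centred_in_hull m (\<phi> ` X)))) \<and>
     ((strictly_quasihypermetric X d \<longleftrightarrow>
        (\<exists>!\<mu>. \<mu> \<in> signed_measures_1 X d \<and> d_invariant X d \<mu>)) \<and>
     ((\<exists>!\<mu>. \<mu> \<in> signed_measures_1 X d \<and> d_invariant X d \<mu>) \<longleftrightarrow>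
        (\<exists>m \<phi>. S_embedding X d m \<phi> \<and> \<not> affine_dependent (\<phi> ` X))) \<and>
     ((\<exists>m \<phi>. S_embedding X d m \<phi> \<and> \<not> affine_dependent (\<phi> ` X)) \<longleftrightarrow>
        (\<forall>m \<phi>. S_embedding X d m \<phi> \<longrightarrow> \<not> affine_dependent (\<phi> ` X))))"
proof -
  interpret finite_quasihypermetric_space X d
    using assms by (simp add: finite_quasihypermetric_space_def finite_quasihypermetric_space_axioms_def)
  have min: "S_embedding X d m \<phi>" if "minimal_S_embedding X d m \<phi>" for m \<phi>
    using that by (simp add: minimal_S_embedding_def)
  \<comment> \<open>Each criterion equates a property of an embedding with one of the space alone,
    so "some" and "every" agree once embeddings, and minimal ones, exist.\<close>
  show ?thesis
    unfolding ex_invariant_signed_measure ex_invariant_prob_measure M_sup_finite_iff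
      M_plus_sup_eq_M_sup_iff strictly_quasihypermetric_iff_ex1_invariant [symmetric]
    using ex_S_embedding ex_minimal_S_embedding lies_on_sphere_iff
      lies_on_sphere_centred_in_hull_iff [OF min] affine_independent_S_embedding_iff
    by (intro conjI) blast+
qed

end
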